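(* Let $k\geq 3$ be an integer and let $[\alpha_1,\alpha_2,\alpha_3]$ be a partition of $2k$ into three positive integers. There exists a rational map $f:\overline{\mathbb{C}}\to\overline{\mathbb{C}}$ of degree $2k$ with branching datum $$\{[\alpha_1,\alpha_2,\alpha_3],[\underbrace{2,\ldots,2}_{k}],[\underbrace{2,\ldots,2}_{k-2},4]\}$$ if and only if $\alpha_j=k$ for some $j\in\{1,2,3\}$.
   Context: $\overline{\mathbb{C}}=\mathbb{C}\cup\{\infty\}$ is the Riemann sphere. Square brackets denote unordered lists with repetitions (multisets). For a non-constant rational map $h:\overline{\mathbb{C}}\to\overline{\mathbb{C}}$ of degree $d$ and $x\in\overline{\mathbb{C}}$, let $\mu(x)$ be the partition of $d$ formed by the local degrees (multiplicities) of $h$ at the points of $h^{-1}(x)$. The branching points of $h$ are the points $x$ of the target for which $\mu(x)$ is not the trivial partition $[1,\ldots,1]$, and the branching datum of $h$ is the collection (with repetitions) of the partitions $\mu(x)$ over all branching points $x$. *)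

theory Defs
  imports "HOL-Complex_Analysis.Complex_Analysis" "HOL-Library.Multiset"
begin

datatype riemann_sphere = Fin complex | Infty

text \<open>The map \<open>p / q\<close> on the sphere, for coprime \<open>p\<close>, \<open>q\<close>. With \<open>n = max (degree p) (degree q)\<close>, the
  value at infinity is the value at \<open>0\<close> of the quotient of \<open>z ^ n * p (1 / z)\<close> and \<open>z ^ n * q (1 / z)\<close>,
  and these have the constant terms \<open>coeff p n\<close> and \<open>coeff q n\<close>.\<close>

fun rat_fun :: "complex poly \<Rightarrow> complex poly \<Rightarrow> riemann_sphere \<Rightarrow> riemann_sphere" where
  "rat_fun p q (Fin z) = (if poly q z = 0 then Infty else Fin (poly p z / poly q z))"
| "rat_fun p q Infty =
     (let n = max (degree p) (degree q)
      in if coeff q n = 0 then Infty else Fin (coeff p n / coeff q n))"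

definition rational_map :: "nat \<Rightarrow> (riemann_sphere \<Rightarrow> riemann_sphere) \<Rightarrow> bool" where
  "rational_map d h \<longleftrightarrow>
     (\<exists>p q. coprime p q \<and> max (degree p) (degree q) = d \<and> h = rat_fun p q)"

text \<open>\<open>coord a\<close> is the holomorphic coordinate centred at \<open>a\<close> (\<open>z - a\<close>, or \<open>1 / z\<close> at infinity) and
  \<open>uncoord a\<close> is its inverse. The values of \<open>coord (Fin a)\<close> at \<open>Infty\<close> and of \<open>coord Infty\<close> at \<open>Fin 0\<close>
  are dummies: these points lie outside the domain of the chart.\<close>

fun coord :: "riemann_sphere \<Rightarrow> riemann_sphere \<Rightarrow> complex" where
  "coord (Fin a) (Fin z) = z - a"
| "coord (Fin a) Infty = 0"
| "coord Infty (Fin z) = inverse z"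
| "coord Infty Infty = 0"

fun uncoord :: "riemann_sphere \<Rightarrow> complex \<Rightarrow> riemann_sphere" where
  "uncoord (Fin a) t = Fin (a + t)"
| "uncoord Infty t = (if t = 0 then Infty else Fin (inverse t))"

definition local_degree :: "(riemann_sphere \<Rightarrow> riemann_sphere) \<Rightarrow> riemann_sphere \<Rightarrow> nat" where
  "local_degree h a = nat (zorder (\<lambda>t. coord (h a) (h (uncoord a t))) 0)"

text \<open>The definitions below are meant for non-constant rational maps: these have finite fibres and
  finitely many branching points, so \<open>mset_set\<close> is always applied to a finite set.\<close>

definition fibre_partition :: "(riemann_sphere \<Rightarrow> riemann_sphere) \<Rightarrow> riemann_sphere \<Rightarrow> nat multiset" where
  "fibre_partition h x = image_mset (local_degree h) (mset_set (h -` {x}))"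

definition branching_points :: "(riemann_sphere \<Rightarrow> riemann_sphere) \<Rightarrow> riemann_sphere set" where
  "branching_points h = {x. fibre_partition h x \<noteq> replicate_mset (size (fibre_partition h x)) 1}"

definition branching_datum :: "(riemann_sphere \<Rightarrow> riemann_sphere) \<Rightarrow> nat multiset multiset" where
  "branching_datum h = image_mset (fibre_partition h) (mset_set (branching_points h))"

end

theory Submission
  imports Defs "HOL-Computational_Algebra.Fundamental_Theorem_Algebra"
begin

text \<open>A rational map of degree \<open>2 * k\<close> with only even local degrees over two points is, after a Moebius
  map of the target that moves these points to \<open>0\<close> and \<open>\<infinity>\<close> and a third point to \<open>1\<close>, the square of a
  rational map \<open>g\<close> of degree \<open>k\<close>. The fibre of \<open>g\<^sup>2\<close> over \<open>1\<close> is the disjoint union of the fibres of \<open>g\<close> over \<open>1\<close> and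
  over \<open>-1\<close>, and the multiplicities in each of these add up to \<open>k\<close>. If the fibre has three points, one of
  the two parts is a single point, of multiplicity \<open>k\<close>. This is the necessity
  (\<open>even_fibres_split_third\<close>, \<open>three_parts_split\<close>).

  Conversely, let \<open>a + b = k\<close>. The partition \<open>[k, a, b]\<close> calls for a map \<open>g\<close> that is totally
  ramified over \<open>1\<close>, has multiplicities \<open>a\<close>, \<open>b\<close> over \<open>-1\<close>, one double pole, and no further
  ramification. Such a \<open>g\<close> is a Moebius map applied to \<open>h = z ^ a * (z - 1) ^ b\<close>: the only
  ramification of \<open>h\<close> outside \<open>0\<close> and \<open>\<infinity>\<close> (as values) is one simple critical point, with a value
  \<open>w \<noteq> 0\<close>. This gives \<open>g = (h + w) / (h - w)\<close>, and \<open>g\<^sup>2\<close> has the required branching datum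
  (\<open>branching_datum_f\<close>).

  Both directions compute with \<open>fibre_partition_rat_fun\<close>: the local degrees of \<open>p / q\<close> over \<open>y\<close> are the
  orders of the zeros of \<open>p - y * q\<close>, infinity included.\<close>

section \<open>Partitions formed by multiplicities\<close>

definition multiplicities :: "'a multiset \<Rightarrow> nat multiset" where
  "multiplicities M = image_mset (count M) (mset_set (set_mset M))"

lemma sum_mset_multiplicities: "sum_mset (multiplicities M) = size M"
  unfolding multiplicities_def by (simp add: size_multiset_overloaded_eq sum_unfold_sum_mset)

lemma multiplicities_add:
  assumes "set_mset M \<inter> set_mset N = {}"
  shows "multiplicities (M + N) = multiplicities M + multiplicities N"
proof -
  have "image_mset (count (M + N)) (mset_set (set_mset M)) = multiplicities M"
       "image_mset (count (M + N)) (mset_set (set_mset N)) = multiplicities N"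
    unfolding multiplicities_def using assms
    by (auto intro!: image_mset_cong simp: not_in_iff)
  then show ?thesis
    using assms by (simp add: multiplicities_def mset_set_Union)
qed

lemma multiplicities_repeat:
  assumes "n > 0"
  shows "multiplicities (repeat_mset n M) = image_mset ((*) n) (multiplicities M)"
proof -
  have "set_mset (repeat_mset n M) = set_mset M"
    using assms by (auto simp flip: count_greater_zero_iff)
  moreover have "count (repeat_mset n M) = (\<lambda>x. n * count M x)" by auto
  ultimately show ?thesis
    by (simp add: multiplicities_def image_mset.compositionality o_def)
qed

lemma multiplicities_replicate:
  "n > 0 \<Longrightarrow> multiplicities (replicate_mset n x) = {#n#}"
  by (simp add: multiplicities_def)

lemma multiplicities_simple:
  assumes "\<And>x. x \<in># M \<Longrightarrow> count M x = 1"
  shows "multiplicities M = replicate_mset (size M) 1"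
proof -
  have *: "multiplicities M = image_mset (\<lambda>_. 1) (mset_set (set_mset M))"
    unfolding multiplicities_def using assms by (intro image_mset_cong) auto
  then have "multiplicities M = replicate_mset (card (set_mset M)) 1"
    by (simp add: image_mset_const_eq)
  then show ?thesis
    by (metis sum_mset_multiplicities sum_mset_replicate_mset mult.right_neutral of_nat_id)
qed

text \<open>Halving every multiplicity is the step that turns a fibre with even local degrees into twice a
  divisor, and later its polynomial into a square.\<close>

lemma even_multiplicities_obtain_half:
  assumes "\<And>m. m \<in># multiplicities M \<Longrightarrow> even m"
  obtains N where "M = repeat_mset 2 N"
proof
  have ev: "even (count M x)" for x
    using assms[of "count M x"] by (cases "x \<in># M") (auto simp: multiplicities_def not_in_iff)
  show "M = repeat_mset 2 (\<Sum>x\<in>set_mset M. replicate_mset (count M x div 2) x)"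
  proof (rule multiset_eqI)
    fix y
    have "count (\<Sum>x\<in>set_mset M. replicate_mset (count M x div 2) x) y
          = (\<Sum>x\<in>set_mset M. if x = y then count M y div 2 else 0)"
      by (auto simp: count_sum intro!: sum.cong)
    also have "\<dots> = count M y div 2"
      by (auto simp: not_in_iff)
    finally show "count M y = count (repeat_mset 2 (\<Sum>x\<in>set_mset M. replicate_mset (count M x div 2) x)) y"
      using ev[of y] by simp
  qed
qed

section \<open>Zeros of polynomials on the sphere\<close>

text \<open>The pair \<open>n\<close>, \<open>W\<close> with \<open>degree W \<le> n\<close> stands for the binary form of degree \<open>n\<close> whose
  dehomogenisation is \<open>W\<close>. Its zero at infinity has order \<open>n - degree W\<close>, and \<open>sphere_zeros\<close> is its
  divisor, of degree \<open>n\<close> whatever the degree of \<open>W\<close>. This puts infinity on the same footing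
  as the finite points, so that no position of the points has to be excluded by a change of coordinates.\<close>

definition sphere_zeros :: "nat \<Rightarrow> complex poly \<Rightarrow> riemann_sphere multiset" where
  "sphere_zeros n W = image_mset Fin (proots W) + replicate_mset (n - degree W) Infty"

text \<open>The value of the form in the representatives \<open>(z, 1)\<close> and \<open>(1, 0)\<close>. It is linear in \<open>W\<close>, which
  makes vanishing at infinity as easy to handle in sums as vanishing at a finite point.\<close>

fun sphere_eval :: "nat \<Rightarrow> complex poly \<Rightarrow> riemann_sphere \<Rightarrow> complex" where
  "sphere_eval n W (Fin z) = poly W z"
| "sphere_eval n W Infty = coeff W n"

lemma count_sphere_zeros_Fin:
  assumes "W \<noteq> 0"
  shows "count (sphere_zeros n W) (Fin z) = order z W"
proof -
  have "Fin -` {Fin z} \<inter> set_mset (proots W) = {z} \<inter> set_mset (proots W)" by auto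
  then show ?thesis
    using assms by (cases "z \<in># proots W") (auto simp: sphere_zeros_def count_image_mset order_root)
qed

lemma count_sphere_zeros_Infty:
  "count (sphere_zeros n W) Infty = n - degree W"
proof -
  have "Infty \<notin># image_mset Fin (proots W)" by auto
  then show ?thesis by (simp only: sphere_zeros_def count_union not_in_iff count_replicate_mset) simp
qed

lemma size_sphere_zeros: "degree W \<le> n \<Longrightarrow> size (sphere_zeros n W) = n"
  by (simp add: sphere_zeros_def size_proots_complex)

lemma sphere_zeros_iff:
  assumes "W \<noteq> 0" "degree W \<le> n"
  shows "x \<in># sphere_zeros n W \<longleftrightarrow> sphere_eval n W x = 0"
proof (cases x)
  case (Fin z)
  then show ?thesis
    using assms by (simp add: count_sphere_zeros_Fin order_root flip: count_greater_zero_iff)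
next
  case Infty
  have "degree W < n \<longleftrightarrow> coeff W n = 0"
    using assms leading_coeff_0_iff[of W] by (metis coeff_eq_0 le_neq_implies_less)
  then show ?thesis
    using Infty by (simp add: count_sphere_zeros_Infty flip: count_greater_zero_iff)
qed

lemma sphere_zeros_mult:
  assumes "U \<noteq> 0" "V \<noteq> 0" "degree U \<le> m" "degree V \<le> n"
  shows "sphere_zeros (m + n) (U * V) = sphere_zeros m U + sphere_zeros n V"
proof -
  have "m + n - (degree U + degree V) = (m - degree U) + (n - degree V)"
    using assms by simp
  then show ?thesis
    using assms by (simp add: sphere_zeros_def proots_mult degree_mult_eq multiset_eq_iff)
qed

lemma sphere_zeros_square:
  assumes "U \<noteq> 0" "degree U \<le> n"
  shows "sphere_zeros (2 * n) (U\<^sup>2) = repeat_mset 2 (sphere_zeros n U)"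
  using sphere_zeros_mult[of U U n n] assms
  by (simp add: power2_eq_square mult_2 multiset_eq_iff)

lemma sphere_zeros_smult:
  "c \<noteq> 0 \<Longrightarrow> sphere_zeros n (smult c W) = sphere_zeros n W"
  by (cases "W = 0") (auto simp: sphere_zeros_def multiset_eq_iff order_smult intro!: arg_cong[where f="image_mset Fin"])

text \<open>A complex polynomial is its leading coefficient times a product over its roots. If the
  roots pair up, the product is a square, and the leading coefficient has a complex square root.\<close>

lemma sphere_zeros_square_obtain:
  assumes "W \<noteq> 0" and "\<And>m. m \<in># multiplicities (sphere_zeros n W) \<Longrightarrow> even m"
  obtains P where "W = P\<^sup>2"
proof -
  have "even m" if m: "m \<in># multiplicities (proots W)" for m
  proof -
    from m obtain z where "z \<in># proots W" "m = order z W"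
      using assms(1) poly_roots_finite[OF assms(1)] by (auto simp: multiplicities_def)
    then have "m = count (sphere_zeros n W) (Fin z)" "Fin z \<in># sphere_zeros n W"
      using assms(1) by (simp_all add: count_sphere_zeros_Fin) (simp add: sphere_zeros_def)
    then show ?thesis
      using assms(2)[of m] by (auto simp: multiplicities_def)
  qed
  then obtain N where N: "proots W = repeat_mset 2 N"
    using even_multiplicities_obtain_half by blast
  define P where "P = smult (csqrt (lead_coeff W)) (\<Prod>x\<in>#N. [:-x, 1:])"
  have "W = smult (lead_coeff W) (\<Prod>x\<in>#proots W. [:-x, 1:])"
    by (simp add: complex_poly_decompose_multiset)
  also have "proots W = N + N"
    by (simp add: N multiset_eq_iff)
  then have "(\<Prod>x\<in>#proots W. [:-x, 1:]) = (\<Prod>x\<in>#N. [:-x, 1:])\<^sup>2"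
    by (simp add: power2_eq_square)
  also have "smult (lead_coeff W) \<dots> = P\<^sup>2"
    by (simp add: P_def power2_eq_square) (simp flip: power2_eq_square)
  finally show ?thesis using that by blast
qed

section \<open>Fibres and local degrees of rational maps\<close>

text \<open>The fibre of \<open>p / q\<close> over a point is the zero divisor of a member of the pencil spanned by \<open>p\<close> and
  \<open>q\<close>, regarded as forms of degree \<open>max (degree p) (degree q)\<close>.\<close>

fun fibre_poly :: "complex poly \<Rightarrow> complex poly \<Rightarrow> riemann_sphere \<Rightarrow> complex poly" where
  "fibre_poly p q (Fin y) = p - smult y q"
| "fibre_poly p q Infty = q"

lemma sphere_eval_fibre_poly:
  "sphere_eval n (fibre_poly p q y) x =
     (case y of Fin c \<Rightarrow> sphere_eval n p x - c * sphere_eval n q x | Infty \<Rightarrow> sphere_eval n q x)"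
  by (cases x; cases y) auto

lemma rat_fun_sphere_eval:
  "rat_fun p q x =
     (let n = max (degree p) (degree q) in
      if sphere_eval n q x = 0 then Infty else Fin (sphere_eval n p x / sphere_eval n q x))"
  by (cases x) (auto simp: Let_def)

lemma zorder_poly_quotient_shift:
  assumes "F \<noteq> 0" "poly G z \<noteq> 0"
  shows "zorder (\<lambda>t. poly F (z + t) / poly G (z + t)) 0 = int (order z F)"
proof -
  obtain R where R: "F = [:-z, 1:] ^ order z F * R" "\<not> [:-z, 1:] dvd R"
    using order_decomp[OF assms(1)] by blast
  show ?thesis
  proof (rule zorder_eqI[where S = "{t. poly G (z + t) \<noteq> 0}" and g = "\<lambda>t. poly R (z + t) / poly G (z + t)"])
    show "open {t. poly G (z + t) \<noteq> 0}"
      by (intro open_Collect_neq continuous_intros)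
    show "poly R (z + 0) / poly G (z + 0) \<noteq> 0"
      using R(2) assms(2) by (simp add: poly_eq_0_iff_dvd)
    show "poly F (z + w) / poly G (z + w) = poly R (z + w) / poly G (z + w) * (w - 0) powi int (order z F)" for w
      by (subst R(1)) simp
  qed (use assms in \<open>auto intro!: holomorphic_intros\<close>)
qed

text \<open>Near infinity, \<open>F (1 / t) = reflect_poly F t / t ^ degree F\<close> with a reflected polynomial that does
  not vanish at \<open>0\<close>, so the order of the quotient is the difference of the degrees.\<close>

lemma zorder_poly_quotient_infinity:
  assumes "F \<noteq> 0" "G \<noteq> 0" "degree F \<le> degree G"
    and eq: "\<And>t. t \<noteq> 0 \<Longrightarrow> f t = poly F (inverse t) / poly G (inverse t)"
  shows "zorder f 0 = int (degree G - degree F)"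
proof (rule zorder_eqI[where S = "{t. poly (reflect_poly G) t \<noteq> 0}"
        and g = "\<lambda>t. poly (reflect_poly F) t / poly (reflect_poly G) t"])
  show "open {t. poly (reflect_poly G) t \<noteq> 0}"
    by (intro open_Collect_neq continuous_intros)
  show "f w = poly (reflect_poly F) w / poly (reflect_poly G) w * (w - 0) powi int (degree G - degree F)"
    if "w \<noteq> 0" for w
    using that assms(3) by (simp add: eq poly_reflect_poly_nz power_diff power_int_diff field_simps)
qed (use assms in \<open>auto intro!: holomorphic_intros\<close>)

lemma coprime_no_common_sphere_zero:
  assumes "coprime p q" "max (degree p) (degree q) = d" "d > 0"
  shows "sphere_eval d p x \<noteq> 0 \<or> sphere_eval d q x \<noteq> 0"
proof (cases x)
  case (Fin z)
  show ?thesis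
    using coprime_poly_0[OF assms(1), of z] Fin by auto
next
  case Infty
  have "p \<noteq> 0 \<or> q \<noteq> 0" "degree p = d \<or> degree q = d"
    using assms by (auto simp: max_def split: if_splits)
  then show ?thesis using Infty assms(3) by (metis degree_0 leading_coeff_0_iff less_irrefl sphere_eval.simps(2))
qed

context
  fixes p q :: "complex poly" and d :: nat
  assumes cop: "coprime p q" and deg: "max (degree p) (degree q) = d" and pos: "d > 0"
begin

lemma fibre_poly_degree_le: "degree (fibre_poly p q y) \<le> d"
  using deg by (cases y) (auto intro!: degree_diff_le order_trans[OF degree_smult_le])

lemma rat_fun_eq_iff: "rat_fun p q x = y \<longleftrightarrow> sphere_eval d (fibre_poly p q y) x = 0"
  using coprime_no_common_sphere_zero[OF cop deg pos, of x]
  by (cases y) (auto simp del: fibre_poly.simps simp: rat_fun_sphere_eval deg sphere_eval_fibre_poly Let_def field_simps)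

lemma fibre_poly_nonzero: "fibre_poly p q y \<noteq> 0"
proof
  assume "fibre_poly p q y = 0"
  then consider c where "p = smult c q" | "q = 0"
    by (cases y) auto
  then show False
  proof cases
    case 1
    then have "q dvd p" by (simp add: dvd_smult)
    then have "is_unit q" using cop by (meson coprime_common_divisor dvd_refl)
    then have "degree q = 0" by (auto elim: is_unit_polyE)
    then show False using 1 deg pos degree_smult_le[of c q] by simp
  next
    case 2
    then have "is_unit p" using cop by simp
    then have "degree p = 0" by (auto elim: is_unit_polyE)
    then show False using 2 deg pos by simp
  qed
qed

text \<open>The dummy value of the chart and the convention \<open>x / 0 = 0\<close> agree here, so the formula holds even
  at points outside the domain of the chart.\<close>

lemma coord_rat_fun_Fin:
  "coord y (rat_fun p q (Fin w)) =
     poly (fibre_poly p q y) w / poly (case y of Fin _ \<Rightarrow> q | Infty \<Rightarrow> p) w"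
  by (cases y) (auto simp: field_simps)

text \<open>In the chart centred at \<open>y\<close> the map is the quotient of the fibre polynomial by the other member
  \<open>G\<close> of the pencil. Since \<open>p\<close> and \<open>q\<close> have no common zero on the sphere, \<open>G\<close> does not
  vanish at \<open>x\<close>, and only the zero of the fibre polynomial contributes to the order.\<close>

lemma local_degree_rat_fun:
  assumes "rat_fun p q x = y"
  shows "local_degree (rat_fun p q) x = count (sphere_zeros d (fibre_poly p q y)) x"
proof -
  define G where "G = (case y of Fin _ \<Rightarrow> q | Infty \<Rightarrow> p)"
  note F = fibre_poly_nonzero[of y]
  have G: "sphere_eval d G x \<noteq> 0"
    using assms coprime_no_common_sphere_zero[OF cop deg pos, of x]
    by (auto simp: G_def rat_fun_sphere_eval deg Let_def split: riemann_sphere.splits if_splits)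
  show ?thesis
  proof (cases x)
    case (Fin z)
    then show ?thesis
      using zorder_poly_quotient_shift[of "fibre_poly p q y" G z] F G assms
      unfolding local_degree_def
      by (simp add: coord_rat_fun_Fin count_sphere_zeros_Fin flip: G_def del: rat_fun.simps)
  next
    case Infty
    have dG: "degree G \<le> d" using deg by (auto simp: G_def split: riemann_sphere.splits)
    have "degree G = d" using G Infty dG by (simp add: le_antisym le_degree)
    moreover have "G \<noteq> 0" using G Infty by auto
    ultimately have "zorder (\<lambda>t. coord y (rat_fun p q (uncoord Infty t))) 0
        = int (d - degree (fibre_poly p q y))"
      using F fibre_poly_degree_le[of y]
      by (subst zorder_poly_quotient_infinity[of "fibre_poly p q y" G])
         (auto simp: coord_rat_fun_Fin simp flip: G_def simp del: rat_fun.simps)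
    then show ?thesis
      using Infty assms by (simp add: local_degree_def count_sphere_zeros_Infty del: uncoord.simps rat_fun.simps)
  qed
qed

lemma fibre_rat_fun: "rat_fun p q -` {y} = set_mset (sphere_zeros d (fibre_poly p q y))"
  using fibre_poly_nonzero[of y] fibre_poly_degree_le[of y] by (simp add: set_eq_iff sphere_zeros_iff rat_fun_eq_iff)

lemma fibre_partition_rat_fun:
  "fibre_partition (rat_fun p q) y = multiplicities (sphere_zeros d (fibre_poly p q y))"
proof -
  have "local_degree (rat_fun p q) x = count (sphere_zeros d (fibre_poly p q y)) x"
    if "x \<in># sphere_zeros d (fibre_poly p q y)" for x
    using that fibre_rat_fun[of y] by (intro local_degree_rat_fun) auto
  then show ?thesis
    unfolding fibre_partition_def multiplicities_def fibre_rat_fun by (intro image_mset_cong) simp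
qed

end

section \<open>A fibre splits when two others have even local degrees\<close>

text \<open>The fibre polynomials form a pencil: two of them span it, and a third one is proportional to neither.\<close>

lemma fibre_poly_pencil:
  assumes "x \<noteq> a" "x \<noteq> b" "a \<noteq> b"
  obtains \<beta> \<gamma> where "\<beta> \<noteq> 0" "\<gamma> \<noteq> 0"
    "fibre_poly p q x = smult \<beta> (fibre_poly p q a) + smult \<gamma> (fibre_poly p q b)"
proof (cases x; cases a; cases b)
  fix u s t assume *: "x = Fin u" "a = Fin s" "b = Fin t"
  then have "(u - t) / (s - t) \<noteq> 0" "(s - u) / (s - t) \<noteq> 0" "s - t \<noteq> 0" using assms by auto
  moreover have "(u - t) / (s - t) + (s - u) / (s - t) = 1"
     "(u - t) / (s - t) * s + (s - u) / (s - t) * t = u"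
    using \<open>s - t \<noteq> 0\<close> by (simp_all add: divide_simps) (simp_all add: algebra_simps)
  then have "fibre_poly p q x = smult ((u - t) / (s - t)) (fibre_poly p q a) + smult ((s - u) / (s - t)) (fibre_poly p q b)"
    using * by (simp add: smult_diff_right algebra_simps flip: smult_add_left)
  ultimately show ?thesis using that by blast
next
  fix u s assume *: "x = Fin u" "a = Fin s" "b = Infty"
  then have "fibre_poly p q x = smult 1 (fibre_poly p q a) + smult (s - u) (fibre_poly p q b)"
    by (simp add: smult_diff_left)
  then show ?thesis using that[of 1 "s - u"] * assms by auto
next
  fix u t assume *: "x = Fin u" "a = Infty" "b = Fin t"
  then have "fibre_poly p q x = smult (t - u) (fibre_poly p q a) + smult 1 (fibre_poly p q b)"
    by (simp add: smult_diff_left)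
  then show ?thesis using that[of "t - u" 1] * assms by auto
next
  fix s t assume *: "x = Infty" "a = Fin s" "b = Fin t"
  then have "t - s \<noteq> 0" using assms by auto
  moreover have "smult (r * (t - s)) q = smult r (fibre_poly p q a) + smult (- r) (fibre_poly p q b)" for r
    using * by (simp add: smult_diff_right smult_diff_left right_diff_distrib)
  from this[of "1 / (t - s)"]
  have "fibre_poly p q x = smult (1 / (t - s)) (fibre_poly p q a) + smult (- (1 / (t - s))) (fibre_poly p q b)"
    using * \<open>t - s \<noteq> 0\<close> by simp
  ultimately show ?thesis using that[of "1 / (t - s)" "- (1 / (t - s))"] \<open>t - s \<noteq> 0\<close> by auto
qed (use assms in auto)

text \<open>After scaling, the polynomials of the two even fibres are squares \<open>P\<^sup>2\<close> and \<open>Q\<^sup>2\<close>, with the signs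
  chosen so that the third is \<open>P\<^sup>2 - Q\<^sup>2 = (P - Q) * (P + Q)\<close>. In other words, up to a Moebius map on the
  target the map is \<open>(P / Q)\<^sup>2\<close>, and the third fibre is the union of the fibres of \<open>P / Q\<close> over \<open>1\<close> and
  \<open>-1\<close>, each of degree \<open>k\<close>.\<close>

lemma even_fibres_split_third:
  assumes "coprime p q" "max (degree p) (degree q) = 2 * k" "k > 0"
    and "x \<noteq> a" "x \<noteq> b" "a \<noteq> b"
    and ev_a: "\<And>m. m \<in># fibre_partition (rat_fun p q) a \<Longrightarrow> even m"
    and ev_b: "\<And>m. m \<in># fibre_partition (rat_fun p q) b \<Longrightarrow> even m"
  obtains M N where "fibre_partition (rat_fun p q) x = M + N" "sum_mset M = k" "sum_mset N = k"
proof -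
  let ?F = "fibre_poly p q"
  have pos: "2 * k > 0" using assms by simp
  note data = assms(1,2) pos
  note nz = fibre_poly_nonzero[OF data] and le = fibre_poly_degree_le[OF data]
  note part = fibre_partition_rat_fun[OF data]
  obtain \<beta> \<gamma> where bg: "\<beta> \<noteq> 0" "\<gamma> \<noteq> 0" "?F x = smult \<beta> (?F a) + smult \<gamma> (?F b)"
    using fibre_poly_pencil assms(4-6) by blast
  obtain P where P: "smult \<beta> (?F a) = P\<^sup>2"
    using sphere_zeros_square_obtain[of "smult \<beta> (?F a)" "2 * k"] nz bg ev_a
    by (auto simp: part sphere_zeros_smult)
  obtain Q where Q: "smult (-\<gamma>) (?F b) = Q\<^sup>2"
    using sphere_zeros_square_obtain[of "smult (-\<gamma>) (?F b)" "2 * k"] nz bg ev_b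
    by (auto simp: part sphere_zeros_smult simp del: smult_minus_left)
  have "2 * degree P \<le> 2 * k" "2 * degree Q \<le> 2 * k"
    using arg_cong[OF P, of degree] arg_cong[OF Q, of degree] le[of a] le[of b] bg
    by (cases "P = 0"; cases "Q = 0"; simp add: degree_power_eq del: smult_minus_left)+
  then have deg: "degree (P - Q) \<le> k" "degree (P + Q) \<le> k" and dPQ: "degree P \<le> k" "degree Q \<le> k"
    by (auto intro: degree_diff_le degree_add_le)
  have "?F x = P\<^sup>2 - Q\<^sup>2" using bg(3) by (simp flip: P Q)
  then have prod: "?F x = (P - Q) * (P + Q)" by (simp add: power2_eq_square algebra_simps)
  then have nz': "P - Q \<noteq> 0" "P + Q \<noteq> 0" using nz[of x] by auto
  \<comment> \<open>A common zero of the two factors is a common zero of \<open>P\<close> and \<open>Q\<close>, hence a point that is mapped to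
    both \<open>a\<close> and \<open>b\<close>.\<close>
  have disj: "set_mset (sphere_zeros k (P - Q)) \<inter> set_mset (sphere_zeros k (P + Q)) = {}"
  proof (rule ccontr)
    assume "\<not> ?thesis"
    then obtain y where "sphere_eval k (P - Q) y = 0" "sphere_eval k (P + Q) y = 0"
      using deg nz' by (auto simp: sphere_zeros_iff)
    then have "sphere_eval k P y = 0" "sphere_eval k Q y = 0"
      by (cases y; auto simp: algebra_simps)+
    moreover have "P \<noteq> 0" "Q \<noteq> 0" using P Q nz bg by auto
    ultimately have "y \<in># sphere_zeros k P" "y \<in># sphere_zeros k Q"
      using dPQ by (simp_all add: sphere_zeros_iff)
    then have "y \<in># sphere_zeros (2 * k) (P\<^sup>2)" "y \<in># sphere_zeros (2 * k) (Q\<^sup>2)"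
      using dPQ \<open>P \<noteq> 0\<close> \<open>Q \<noteq> 0\<close> by (auto simp: sphere_zeros_square simp flip: count_greater_zero_iff)
    then have "y \<in># sphere_zeros (2 * k) (?F a)" "y \<in># sphere_zeros (2 * k) (?F b)"
      using bg by (simp_all add: sphere_zeros_smult flip: P Q del: smult_minus_left)
    then have "rat_fun p q y = a" "rat_fun p q y = b"
      by (auto simp flip: fibre_rat_fun[OF data])
    then show False using \<open>a \<noteq> b\<close> by simp
  qed
  have "fibre_partition (rat_fun p q) x
      = multiplicities (sphere_zeros k (P - Q)) + multiplicities (sphere_zeros k (P + Q))"
    using sphere_zeros_mult[OF nz' deg] disj
    by (simp add: part prod mult_2 multiplicities_add)
  then show ?thesis
    using that by (metis sum_mset_multiplicities size_sphere_zeros deg)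
qed

text \<open>Both halves are non-empty, so one of them consists of a single part.\<close>

lemma three_parts_split:
  fixes k a b c :: nat
  assumes "{#a, b, c#} = M + N" "sum_mset M = k" "sum_mset N = k" "k > 0"
  shows "a = k \<or> b = k \<or> c = k"
proof -
  have single: "k \<in># {#a, b, c#}" if L: "size L = 1" "sum_mset L = k" "L \<subseteq># {#a, b, c#}" for L
  proof -
    obtain y where "L = {#y#}" using size_1_singleton_mset[OF L(1)] by blast
    then show ?thesis using L(2,3) by (auto dest: mset_subset_eqD)
  qed
  have "size M + size N = 3" using arg_cong[OF assms(1), of size] by simp
  moreover have "size M \<noteq> 0" "size N \<noteq> 0" using assms by auto
  ultimately have "size M = 1 \<or> size N = 1" by linarith
  then have "k \<in># {#a, b, c#}"
    using single assms by (metis mset_subset_eq_add_left mset_subset_eq_add_right)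
  then show ?thesis by auto
qed

text \<open>The datum is a multiset of partitions, so two of \<open>A\<close>, \<open>B\<close>, \<open>C\<close> may coincide; the points that carry
  them are still distinct because the datum is indexed by a set of points.\<close>

lemma three_branching_points:
  assumes "branching_datum f = {#A, B, C#}"
  obtains x a b where "x \<noteq> a" "x \<noteq> b" "a \<noteq> b"
    "fibre_partition f x = A" "fibre_partition f a = B" "fibre_partition f b = C"
proof -
  let ?S = "mset_set (branching_points f)"
  have "image_mset (fibre_partition f) ?S = {#A, B, C#}"
    using assms by (simp add: branching_datum_def)
  then obtain M x where M: "?S = add_mset x M" "fibre_partition f x = A"
      "image_mset (fibre_partition f) M = {#B, C#}"
    using msed_map_invR by metis
  then obtain N a where N: "M = add_mset a N" "fibre_partition f a = B"
      "image_mset (fibre_partition f) N = {#C#}"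
    using msed_map_invR by metis
  then obtain b where b: "N = {#b#}" "fibre_partition f b = C"
    using msed_map_invR[of "fibre_partition f" N C "{#}"] by auto
  have "?S = {#x, a, b#}" using M N b by simp
  moreover have "count ?S y \<le> 1" for y
    by (cases "finite (branching_points f)"; cases "y \<in> branching_points f") auto
  from this[of x] this[of a] have "count ?S x \<le> 1" "count ?S a \<le> 1" .
  ultimately have "x \<noteq> a" "x \<noteq> b" "a \<noteq> b"
    by (auto split: if_splits)
  then show ?thesis using that M N b by blast
qed

section \<open>A rational map with the required branching\<close>

text \<open>The polynomial \<open>h = z ^ a * (z - 1) ^ b\<close> is totally ramified at infinity. Apart from its two roots
  it has one finite critical point \<open>c = a / (a + b)\<close>, which is simple; \<open>w\<close> is the critical value there.\<close>

locale two_root_polynomial =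
  fixes a b :: nat
  assumes a: "a > 0" and b: "b > 0"
begin

definition h :: "complex poly" where "h = [:0, 1:] ^ a * [:-1, 1:] ^ b"
definition c :: complex where "c = of_nat a / of_nat (a + b)"
definition w :: complex where "w = poly h c"

lemma c_nonzero_ne_1: "c \<noteq> 0" "c \<noteq> 1"
  using a b by (auto simp: c_def field_simps simp flip: of_nat_add)

lemma w_nonzero: "w \<noteq> 0"
  using c_nonzero_ne_1 by (simp add: w_def h_def)

lemma degree_h: "degree h = a + b"
  by (simp add: h_def degree_mult_eq degree_power_eq)

lemma pderiv_h:
  "pderiv h = smult (of_nat (a + b)) ([:0, 1:] ^ (a - 1) * [:-1, 1:] ^ (b - 1) * [:-c, 1:])"
proof (rule poly_eq_poly_eq_iff[THEN iffD1])
  obtain a' b' where *: "a = Suc a'" "b = Suc b'" using a b by (auto simp: gr0_conv_Suc)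
  have c: "of_nat (a + b) * c = of_nat a"
    using a by (simp add: c_def del: of_nat_add)
  show "poly (pderiv h) = poly (smult (of_nat (a + b)) ([:0, 1:] ^ (a - 1) * [:-1, 1:] ^ (b - 1) * [:-c, 1:]))"
  proof
    fix x
    have "poly (smult (of_nat (a + b)) ([:0, 1:] ^ (a - 1) * [:-1, 1:] ^ (b - 1) * [:-c, 1:])) x
       = x ^ a' * (x - 1) ^ b' * (of_nat (a + b) * x - of_nat (a + b) * c)"
      by (simp add: * algebra_simps)
    also have "\<dots> = x ^ a' * (x - 1) ^ b' * (of_nat a * (x - 1) + of_nat b * x)"
      unfolding c by (simp add: algebra_simps)
    also have "\<dots> = poly (pderiv h) x"
      unfolding h_def unfolding * pderiv_mult pderiv_power_Suc by (simp add: pderiv_pCons algebra_simps)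
    finally show "poly (pderiv h) x = poly (smult (of_nat (a + b)) ([:0, 1:] ^ (a - 1) * [:-1, 1:] ^ (b - 1) * [:-c, 1:])) x" ..
  qed
qed

lemma critical_values_h:
  assumes "poly (pderiv h) z = 0"
  shows "poly h z = 0 \<or> z = c \<and> poly h z = w"
proof -
  have "z = 0 \<or> z = 1 \<or> z = c"
    using assms a unfolding pderiv_h by (auto simp del: of_nat_add)
  then show ?thesis
    using a b by (auto simp: h_def w_def)
qed

lemma degree_h_shift: "degree (h + [:u:]) = a + b"
  using a degree_h by (subst degree_add_eq_left) auto

lemma h_shift_nonzero: "h + [:u:] \<noteq> 0"
  using degree_h_shift[of u] a by auto

lemma multiplicities_h:
  "multiplicities (sphere_zeros (2 * (a + b)) h) = {#a + b, a, b#}"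
proof -
  have "proots h = replicate_mset a 0 + replicate_mset b 1"
    unfolding h_def by (subst proots_mult) (auto simp: proots_power)
  then have "sphere_zeros (2 * (a + b)) h
      = replicate_mset a (Fin 0) + (replicate_mset b (Fin 1) + replicate_mset (a + b) Infty)"
    by (simp add: sphere_zeros_def degree_h add.commute[of b a])
  then show ?thesis
    using a b by (simp add: multiplicities_add multiplicities_replicate)
qed

text \<open>A multiple root of \<open>h + u\<close> is a critical point of \<open>h\<close> with value \<open>-u\<close>. For \<open>u \<noteq> 0\<close> this leaves only
  \<open>c\<close>, where \<open>pderiv h\<close> has a simple zero.\<close>

lemma order_h_shift:
  assumes "poly (h + [:u:]) z = 0" "u \<noteq> 0"
  shows "order z (h + [:u:]) = (if u = -w \<and> z = c then 2 else 1)"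
proof -
  have *: "order z (h + [:u:]) = Suc (order z (pderiv h))"
    using order_pderiv[OF h_shift_nonzero assms(1)] by (simp add: pderiv_add)
  show ?thesis
  proof (cases "u = -w \<and> z = c")
    case True
    have "order c ([:0, 1:] ^ (a - 1) * [:-1, 1:] ^ (b - 1)) = 0"
      using c_nonzero_ne_1 by (intro order_0I) auto
    moreover have "order c [:-c, 1:] = 1"
      using order_power_n_n[of c 1] by simp
    ultimately have "order c (pderiv h) = 1"
      unfolding pderiv_h using a
      by (subst order_smult, simp del: of_nat_add, subst order_mult)
         (simp_all del: mult_pCons_right mult_pCons_left)
    then show ?thesis using * True by simp
  next
    case False
    have "poly h z = - u" using assms(1) by (simp add: eq_neg_iff_add_eq_0)
    then have "poly (pderiv h) z \<noteq> 0"
      using critical_values_h[of z] False assms(2) by (metis minus_minus neg_equal_0_iff_equal)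
    then show ?thesis using * False by (auto simp: order_0I)
  qed
qed

lemma sphere_zeros_h_shift:
  assumes "u \<noteq> 0" "x \<in># sphere_zeros (a + b) (h + [:u:])"
  shows "count (sphere_zeros (a + b) (h + [:u:])) x = (if u = -w \<and> x = Fin c then 2 else 1)"
proof (cases x)
  case (Fin z)
  then have "poly (h + [:u:]) z = 0"
    using assms(2) h_shift_nonzero degree_h_shift by (simp add: sphere_zeros_iff)
  then show ?thesis
    using Fin order_h_shift assms(1) h_shift_nonzero by (simp add: count_sphere_zeros_Fin)
next
  case Infty
  then show ?thesis
    using assms(2) degree_h_shift by (simp add: count_sphere_zeros_Infty flip: count_greater_zero_iff)
qed

lemma multiplicities_h_plus:
  "multiplicities (sphere_zeros (a + b) (h + [:w:])) = replicate_mset (a + b) 1"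
  using multiplicities_simple[of "sphere_zeros (a + b) (h + [:w:])"] sphere_zeros_h_shift[of w] w_nonzero
  by (simp add: size_sphere_zeros degree_h_shift)

lemma multiplicities_h_minus:
  "multiplicities (sphere_zeros (a + b) (h + [:-w:])) = add_mset 2 (replicate_mset (a + b - 2) 1)"
proof -
  let ?M = "sphere_zeros (a + b) (h + [:-w:])"
  define N where "N = filter_mset (\<lambda>x. x \<noteq> Fin c) ?M"
  have "Fin c \<in># ?M"
    using h_shift_nonzero degree_h_shift by (simp add: sphere_zeros_iff w_def)
  then have "count ?M (Fin c) = 2"
    using sphere_zeros_h_shift[of "-w" "Fin c"] w_nonzero by simp
  then have M: "?M = replicate_mset 2 (Fin c) + N"
    unfolding N_def by (auto simp: multiset_eq_iff)
  have "size N = a + b - 2"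
    using arg_cong[OF M, of size] by (simp add: size_sphere_zeros degree_h_shift)
  moreover have "multiplicities N = replicate_mset (size N) 1"
    using sphere_zeros_h_shift[of "-w"] w_nonzero by (intro multiplicities_simple) (auto simp: N_def)
  moreover have "multiplicities ?M = multiplicities (replicate_mset 2 (Fin c)) + multiplicities N"
    unfolding M by (rule multiplicities_add) (auto simp: N_def)
  ultimately show ?thesis by (simp add: multiplicities_replicate)
qed

text \<open>The quotient \<open>(h + w) / (h - w)\<close> is \<open>h\<close> followed by the Moebius map that sends
  \<open>w\<close>, \<open>\<infinity>\<close> and \<open>0\<close> to \<open>\<infinity>\<close>, \<open>1\<close> and \<open>-1\<close>. Squaring merges the last two into one fibre, and
  doubles the multiplicities over \<open>0\<close> and over \<open>\<infinity>\<close>.\<close>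

definition p :: "complex poly" where "p = (h + [:w:])\<^sup>2"
definition q :: "complex poly" where "q = (h + [:-w:])\<^sup>2"

lemma degree_p: "degree p = 2 * (a + b)" and degree_q: "degree q = 2 * (a + b)"
  using h_shift_nonzero by (simp_all add: p_def q_def degree_power_eq degree_h_shift del: add_pCons)

lemma p_minus_q: "p - q = smult (4 * w) h"
proof -
  have "poly (p - q) x = poly (smult (4 * w) h) x" for x
    by (simp add: p_def q_def power2_eq_square algebra_simps)
  then show ?thesis by (simp add: poly_eq_poly_eq_iff[symmetric] fun_eq_iff del: poly_diff poly_smult)
qed

text \<open>At a common root both \<open>h + w\<close> and \<open>h - w\<close> vanish, which forces \<open>w = 0\<close>.\<close>

lemma coprime_p_q: "coprime p q"
proof (rule coprimeI)
  fix r assume r: "r dvd p" "r dvd q"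
  have "poly r z \<noteq> 0" for z
  proof
    assume "poly r z = 0"
    then have "poly p z = 0" "poly q z = 0" using r by (auto elim!: dvdE)
    then show False using w_nonzero by (simp add: p_def q_def)
  qed
  then have "degree r = 0"
    using fundamental_theorem_of_algebra[of r] constant_degree[of r] by blast
  moreover have "r \<noteq> 0" using r(1) degree_p a by auto
  ultimately show "is_unit r" by (simp add: is_unit_iff_degree)
qed

lemma max_degree: "max (degree p) (degree q) = 2 * (a + b)"
  by (simp add: degree_p degree_q)

lemma degree_pos: "0 < 2 * (a + b)"
  using a by simp

lemmas fibre_partition_f = fibre_partition_rat_fun[OF coprime_p_q max_degree degree_pos]

lemma fibre_0: "fibre_partition (rat_fun p q) (Fin 0) = replicate_mset (a + b) 2"
  using sphere_zeros_square[of "h + [:w:]" "a + b"] h_shift_nonzero degree_h_shift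
  unfolding fibre_partition_f
  by (simp add: p_def multiplicities_repeat multiplicities_h_plus del: add_pCons)

lemma fibre_Infty: "fibre_partition (rat_fun p q) Infty = replicate_mset (a + b - 2) 2 + {#4#}"
  using sphere_zeros_square[of "h + [:-w:]" "a + b"] h_shift_nonzero degree_h_shift
  unfolding fibre_partition_f
  by (simp add: q_def multiplicities_repeat multiplicities_h_minus del: add_pCons)

lemma fibre_1: "fibre_partition (rat_fun p q) (Fin 1) = {#a + b, a, b#}"
  using w_nonzero unfolding fibre_partition_f
  by (simp add: p_minus_q sphere_zeros_smult multiplicities_h del: distrib_left_numeral)

text \<open>A multiple root of \<open>p - y * q\<close> is a critical point of \<open>h\<close> or a point with
  \<open>h + w = y * (h - w)\<close>. The critical points lie over \<open>1\<close> and \<open>\<infinity>\<close>. In the second case,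
  \<open>(h + w)\<^sup>2 = y * (h - w)\<^sup>2\<close> gives \<open>y\<^sup>2 * (h - w)\<^sup>2 = y * (h - w)\<^sup>2\<close>, which leaves only \<open>h = w\<close>
  for \<open>y\<close> other than \<open>0\<close> and \<open>1\<close>, and then \<open>h + w = 0\<close> as well, against \<open>w \<noteq> 0\<close>. Infinity is not in the fibre because \<open>p\<close> and \<open>q\<close> have the same leading
  coefficient.\<close>

lemma fibre_other:
  assumes "y \<noteq> 0" "y \<noteq> 1"
  shows "fibre_partition (rat_fun p q) (Fin y) = replicate_mset (2 * (a + b)) 1"
proof -
  let ?F = "p - smult y q" and ?n = "2 * (a + b)"
  have lc: "coeff p ?n = (lead_coeff h)\<^sup>2" "coeff q ?n = (lead_coeff h)\<^sup>2"
  proof -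
    have "coeff p ?n = lead_coeff p" "coeff q ?n = lead_coeff q" by (simp_all add: degree_p degree_q)
    moreover have "lead_coeff (h + [:u:]) = lead_coeff h" for u
      using degree_h_shift[of u] a by (simp add: degree_h coeff_pCons split: nat.split)
    ultimately show "coeff p ?n = (lead_coeff h)\<^sup>2" "coeff q ?n = (lead_coeff h)\<^sup>2"
      by (simp_all add: p_def q_def lead_coeff_power del: add_pCons)
  qed
  have "coeff ?F ?n = (1 - y) * (lead_coeff h)\<^sup>2"
    unfolding coeff_diff coeff_smult lc by (simp add: algebra_simps)
  moreover have "h \<noteq> 0" using degree_h a by auto
  ultimately have top: "coeff ?F ?n \<noteq> 0" using assms by simp
  then have nz: "?F \<noteq> 0" by auto
  have simple: "order z ?F = 1" if root: "poly ?F z = 0" for z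
  proof -
    let ?v = "poly h z"
    have root': "(?v + w)\<^sup>2 = y * (?v - w)\<^sup>2"
      using root by (simp add: p_def q_def)
    have "poly (pderiv ?F) z \<noteq> 0"
    proof
      assume "poly (pderiv ?F) z = 0"
      then have "2 * poly (pderiv h) z * ((?v + w) - y * (?v - w)) = 0"
        by (simp add: p_def q_def power2_eq_square pderiv_diff pderiv_smult pderiv_mult pderiv_add algebra_simps)
      then consider "poly (pderiv h) z = 0" | "?v + w = y * (?v - w)" by auto
      then show False
      proof cases
        case 1
        then have "?v = 0 \<or> ?v = w" using critical_values_h by auto
        then show False using root' w_nonzero assms by auto
      next
        case 2
        then have "y\<^sup>2 * (?v - w)\<^sup>2 = y * (?v - w)\<^sup>2"
          using root' by (simp add: power_mult_distrib)
        then have "?v = w" using assms by (simp add: power2_eq_square)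
        then show False using root' w_nonzero by simp
      qed
    qed
    then show ?thesis using order_pderiv[OF nz root] by (simp add: order_0I)
  qed
  have le: "degree ?F \<le> ?n" using fibre_poly_degree_le[OF coprime_p_q max_degree degree_pos, of "Fin y"] by simp
  have "count (sphere_zeros ?n ?F) x = 1" if "x \<in># sphere_zeros ?n ?F" for x
  proof (cases x)
    case (Fin z)
    then show ?thesis using that simple nz le by (simp add: sphere_zeros_iff count_sphere_zeros_Fin del: poly_diff)
  next
    case Infty
    then show ?thesis using that top nz le by (simp add: sphere_zeros_iff del: coeff_diff)
  qed
  then show ?thesis
    using multiplicities_simple[of "sphere_zeros ?n ?F"] le by (simp add: fibre_partition_f size_sphere_zeros)
qed

lemma branching_points_f:
  assumes "a + b \<ge> 3"
  shows "branching_points (rat_fun p q) = {Fin 1, Fin 0, Infty}"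
proof -
  have "x \<in> {Fin 1, Fin 0, Infty}" if "x \<in> branching_points (rat_fun p q)" for x
  proof (cases x)
    case (Fin y)
    then show ?thesis
      using that fibre_other[of y] by (cases "y = 0"; cases "y = 1") (auto simp: branching_points_def)
  qed simp
  moreover have "x \<in> branching_points (rat_fun p q)"
    if m: "m \<in># fibre_partition (rat_fun p q) x" "m \<noteq> 1" for m x
    using m unfolding branching_points_def by (metis (mono_tags) in_replicate_mset mem_Collect_eq)
  from this[of "a + b" "Fin 1"] this[of 2 "Fin 0"] this[of 4 "Infty"]
  have "{Fin 1, Fin 0, Infty} \<subseteq> branching_points (rat_fun p q)"
    using assms a by (simp add: fibre_0 fibre_1 fibre_Infty)
  ultimately show ?thesis by blast
qed

lemma branching_datum_f:
  assumes "a + b \<ge> 3"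
  shows "branching_datum (rat_fun p q) =
    {# {#a + b, a, b#}, replicate_mset (a + b) 2, replicate_mset (a + b - 2) 2 + {#4#} #}"
  unfolding branching_datum_def branching_points_f[OF assms]
  by (simp add: fibre_0 fibre_1 fibre_Infty)

end

lemma rational_map_realizing:
  assumes "k \<ge> 3" "a > 0" "b > 0" "a + b = k"
  shows "\<exists>f. rational_map (2 * k) f \<and> branching_datum f =
    {# {#k, a, b#}, replicate_mset k 2, replicate_mset (k - 2) 2 + {#4#} #}"
proof -
  interpret two_root_polynomial a b using assms by unfold_locales
  show ?thesis
    using coprime_p_q max_degree branching_datum_f assms unfolding rational_map_def by blast
qed

section \<open>The characterisation of the realisable partitions\<close>

theorem theorem3p2:
  fixes k \<alpha>\<^sub>1 \<alpha>\<^sub>2 \<alpha>\<^sub>3 :: nat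
  assumes "k \<ge> 3"
    and "\<alpha>\<^sub>1 > 0" and "\<alpha>\<^sub>2 > 0" and "\<alpha>\<^sub>3 > 0"
    and "\<alpha>\<^sub>1 + \<alpha>\<^sub>2 + \<alpha>\<^sub>3 = 2 * k"
  shows "(\<exists>f. rational_map (2 * k) f \<and>
              branching_datum f =
                {# {#\<alpha>\<^sub>1, \<alpha>\<^sub>2, \<alpha>\<^sub>3#},
                   replicate_mset k 2,
                   replicate_mset (k - 2) 2 + {#4#} #})
         \<longleftrightarrow> (\<alpha>\<^sub>1 = k \<or> \<alpha>\<^sub>2 = k \<or> \<alpha>\<^sub>3 = k)"
    (is "?realizable \<longleftrightarrow> ?has_half")
proof
  assume ?realizable
  then obtain p q where pq: "coprime p q" "max (degree p) (degree q) = 2 * k"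
      and datum: "branching_datum (rat_fun p q) =
        {# {#\<alpha>\<^sub>1, \<alpha>\<^sub>2, \<alpha>\<^sub>3#}, replicate_mset k 2, replicate_mset (k - 2) 2 + {#4#} #}"
    unfolding rational_map_def by blast
  obtain x a b where distinct: "x \<noteq> a" "x \<noteq> b" "a \<noteq> b"
    and fibres: "fibre_partition (rat_fun p q) x = {#\<alpha>\<^sub>1, \<alpha>\<^sub>2, \<alpha>\<^sub>3#}"
      "fibre_partition (rat_fun p q) a = replicate_mset k 2"
      "fibre_partition (rat_fun p q) b = replicate_mset (k - 2) 2 + {#4#}"
    using three_branching_points[OF datum] by blast
  have "k > 0" using assms(1) by simp
  have "even m" if "m \<in># fibre_partition (rat_fun p q) a \<or> m \<in># fibre_partition (rat_fun p q) b" for m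
    using that unfolding fibres by (auto simp: in_replicate_mset split: if_splits)
  then obtain M N where "{#\<alpha>\<^sub>1, \<alpha>\<^sub>2, \<alpha>\<^sub>3#} = M + N" "sum_mset M = k" "sum_mset N = k"
    using even_fibres_split_third[OF pq \<open>k > 0\<close> distinct] unfolding fibres(1) by blast
  then show ?has_half
    using three_parts_split assms(1) by fastforce
next
  assume ?has_half
  then obtain a b where "{#\<alpha>\<^sub>1, \<alpha>\<^sub>2, \<alpha>\<^sub>3#} = {#k, a, b#}" "a > 0" "b > 0" "a + b = k"
  proof (elim disjE)
    assume "\<alpha>\<^sub>1 = k"
    then show thesis using assms by (intro that[of \<alpha>\<^sub>2 \<alpha>\<^sub>3]) auto
  next
    assume "\<alpha>\<^sub>2 = k"
    then show thesis using assms by (intro that[of \<alpha>\<^sub>1 \<alpha>\<^sub>3]) auto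
  next
    assume "\<alpha>\<^sub>3 = k"
    then show thesis using assms by (intro that[of \<alpha>\<^sub>1 \<alpha>\<^sub>2]) auto
  qed
  then show ?realizable
    using rational_map_realizing assms(1) by simp
qed

end
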